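(* Let $\mathcal{A}$ be the $n$-dimensional null-filiform associative algebra over $\mathbb{C}$ with basis $e_1,\dots,e_n$, and let $P_0$ be a homogeneous Reynolds operator with degree $0$ on $\mathcal{A}$, with associated function $\psi$. Then: (a) If $\psi(t)\neq 0$ for some $1\le t\le\lfloor n/2\rfloor$, then \[P_0(e_i)=\begin{cases}\frac{t\psi(t)}{i-(i-t)\psi(t)}e_i, & i\equiv 0 \ (\bmod\ t),\\ 0, & \text{otherwise;}\end{cases}\] (b) If $\psi(t)=0$ for all $1\le t\le\lfloor n/2\rfloor$, then \[P_0(e_i)=\begin{cases}\psi(r)e_r, & i=r,\\ 0, & \text{otherwise,}\end{cases}\] for some fixed $\lfloor n/2\rfloor<r\le n$.
   Context: The $n$-dimensional null-filiform associative algebra $\mathcal{A}$ over $\mathbb{C}$ has basis $e_1,\dots,e_n$ and bilinear product $e_ie_j=e_{i+j}$ if $i+j\le n$, and $e_ie_j=0$ otherwise. A homogeneous operator of degree $0$ on $\mathcal{A}$ is a linear map $P_0$ with $P_0(e_i)=\psi(i)e_i$ for $1\le i\le n$, where $\psi:\mathbb{N}\to\mathbb{C}$ is a function. A Reynolds operator is a linear map $P:\mathcal{A}\to\mathcal{A}$ with $P(x)P(y)=P(xP(y)+P(x)y-P(x)P(y))$ for all $x,y\in\mathcal{A}$.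
   Formalization: In (a) the formula is asserted for some t ≤ ⌊n/2⌋ with ψ(t) ≠ 0 (necessarily the least such t), not for every such t: for n = 4 and P_0 the identity, t = 2 has ψ(2) ≠ 0, but the formula would give P_0(e_1) = 0. *)

theory Defs
  imports Complex_Main
begin

locale assoc_algebra = vector_space scale
  for scale :: "complex \<Rightarrow> 'a::ab_group_add \<Rightarrow> 'a" +
  fixes mult :: "'a \<Rightarrow> 'a \<Rightarrow> 'a"
  assumes linear_mult_right: "\<And>x. Vector_Spaces.linear scale scale (\<lambda>y. mult x y)"
    and linear_mult_left: "\<And>y. Vector_Spaces.linear scale scale (\<lambda>x. mult x y)"
    and mult_assoc: "\<And>x y z. mult (mult x y) z = mult x (mult y z)"

text \<open>
  The underlying space of the algebra is the whole type \<open>'a\<close>. Only the values \<open>e 1, \<dots>, e n\<close>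
  matter; \<open>inj_on\<close> is needed because \<open>independent\<close> speaks about the set of these
  values, not about the family. Associativity is already forced by the multiplication table.
\<close>
locale null_filiform_algebra = assoc_algebra scale mult
  for scale :: "complex \<Rightarrow> 'a::ab_group_add \<Rightarrow> 'a" and mult :: "'a \<Rightarrow> 'a \<Rightarrow> 'a" +
  fixes n :: nat and e :: "nat \<Rightarrow> 'a"
  assumes dim_pos: "1 \<le> n"
    and inj_basis: "inj_on e {1..n}"
    and independent_basis: "independent (e ` {1..n})"
    and span_basis: "span (e ` {1..n}) = UNIV"
    and mult_basis: "\<And>i j. i \<in> {1..n} \<Longrightarrow> j \<in> {1..n} \<Longrightarrow>
      mult (e i) (e j) = (if i + j \<le> n then e (i + j) else 0)"

definition homogeneous_operator_degree0 ::
    "(complex \<Rightarrow> 'a::ab_group_add \<Rightarrow> 'a) \<Rightarrow> nat \<Rightarrow> (nat \<Rightarrow> 'a) \<Rightarrow> (nat \<Rightarrow> complex) \<Rightarrow> ('a \<Rightarrow> 'a) \<Rightarrow> bool"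
  where "homogeneous_operator_degree0 scale n e \<psi> P \<longleftrightarrow>
    Vector_Spaces.linear scale scale P \<and> (\<forall>i\<in>{1..n}. P (e i) = scale (\<psi> i) (e i))"

definition reynolds_operator ::
    "(complex \<Rightarrow> 'a::ab_group_add \<Rightarrow> 'a) \<Rightarrow> ('a \<Rightarrow> 'a \<Rightarrow> 'a) \<Rightarrow> ('a \<Rightarrow> 'a) \<Rightarrow> bool"
  where "reynolds_operator scale mult P \<longleftrightarrow>
    Vector_Spaces.linear scale scale P \<and>
    (\<forall>x y. mult (P x) (P y) = P (mult x (P y) + mult (P x) y - mult (P x) (P y)))"

end

theory Submission
  imports Defs
begin

text \<open>
  Evaluated on basis vectors, the Reynolds identity says
  \<open>\<psi> i * \<psi> j = (\<psi> i + \<psi> j - \<psi> i * \<psi> j) * \<psi> (i + j)\<close> whenever \<open>i + j \<le> n\<close>. Hence the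
  support of \<open>\<psi>\<close> is closed under addition, and adding an element of the support to an element
  outside of it stays outside. With \<open>t\<close> the least element of the support, the support therefore consists of
  the multiples of \<open>t\<close>, on which \<open>1 / \<psi> - 1\<close> is additive. If \<open>\<psi>\<close> vanishes up to \<open>n div 2\<close>, two
  elements of the support would differ by an element outside of it, so there is at most one.
\<close>

text \<open>This isolates the arithmetic of \<psi> from the algebra. Pairs with
  \<open>i + j > n\<close> impose nothing, since all products in the Reynolds identity are then
  zero.\<close>

definition reynolds_weight :: "nat \<Rightarrow> (nat \<Rightarrow> 'a::comm_ring_1) \<Rightarrow> bool" where
  "reynolds_weight n \<psi> \<longleftrightarrow> (\<forall>i j. 1 \<le> i \<longrightarrow> 1 \<le> j \<longrightarrow> i + j \<le> n \<longrightarrow>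
     \<psi> i * \<psi> j = (\<psi> i + \<psi> j - \<psi> i * \<psi> j) * \<psi> (i + j))"

lemma reynolds_weightD:
  "reynolds_weight n \<psi> \<Longrightarrow> 1 \<le> i \<Longrightarrow> 1 \<le> j \<Longrightarrow> i + j \<le> n \<Longrightarrow>
    \<psi> i * \<psi> j = (\<psi> i + \<psi> j - \<psi> i * \<psi> j) * \<psi> (i + j)"
  by (simp add: reynolds_weight_def)

text \<open>For \<open>x = e i\<close> and \<open>y = e j\<close> both sides of the Reynolds
  identity are multiples of \<open>e (i + j)\<close>. This vector is nonzero by independence, so the
  coefficients agree.\<close>

lemma (in null_filiform_algebra) reynolds_weight_of_operator:
  assumes hom: "homogeneous_operator_degree0 scale n e \<psi> P"
    and rey: "reynolds_operator scale mult P"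
  shows "reynolds_weight n \<psi>"
  unfolding reynolds_weight_def
proof (intro allI impI)
  fix i j :: nat
  assume i: "1 \<le> i" and j: "1 \<le> j" and ij: "i + j \<le> n"
  interpret P: Vector_Spaces.linear scale scale P
    using rey by (simp add: reynolds_operator_def)
  interpret R: Vector_Spaces.linear scale scale "mult x" for x
    by (rule linear_mult_right)
  interpret L: Vector_Spaces.linear scale scale "\<lambda>x. mult x y" for y
    by (rule linear_mult_left)
  have Pe: "P (e k) = scale (\<psi> k) (e k)" if "1 \<le> k" "k \<le> n" for k
    using hom that by (simp add: homogeneous_operator_degree0_def)
  have prod: "mult (e i) (e j) = e (i + j)"
    using mult_basis[of i j] i j ij by simp
  have nz: "e (i + j) \<noteq> 0"
  proof
    assume "e (i + j) = 0"
    moreover have "e (i + j) \<in> e ` {1..n}"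
      using i ij by simp
    ultimately show False
      using independent_basis dependent_zero by metis
  qed
  have "mult (P (e i)) (P (e j)) =
      P (mult (e i) (P (e j)) + mult (P (e i)) (e j) - mult (P (e i)) (P (e j)))"
    using rey by (simp add: reynolds_operator_def)
  also have "mult (e i) (P (e j)) + mult (P (e i)) (e j) - mult (P (e i)) (P (e j)) =
      scale (\<psi> i + \<psi> j - \<psi> i * \<psi> j) (e (i + j))"
    using i j ij
    by (simp add: Pe L.scale R.scale prod scale_left_distrib scale_left_diff_distrib)
  finally have "scale (\<psi> i * \<psi> j) (e (i + j)) =
      scale ((\<psi> i + \<psi> j - \<psi> i * \<psi> j) * \<psi> (i + j)) (e (i + j))"
    using i j ij by (simp add: Pe L.scale R.scale P.scale prod mult.commute[of "\<psi> j" "\<psi> i"])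
  then show "\<psi> i * \<psi> j = (\<psi> i + \<psi> j - \<psi> i * \<psi> j) * \<psi> (i + j)"
    using nz scale_right_imp_eq by blast
qed

text \<open>With \<open>\<psi> i = 0\<close> the identity collapses to
  \<open>0 = \<psi> j * \<psi> (i + j)\<close>, and \<open>\<psi> j\<close> cancels.\<close>

lemma reynolds_weight_zero_add:
  fixes \<psi> :: "nat \<Rightarrow> 'a::idom"
  assumes "reynolds_weight n \<psi>" "1 \<le> i" "1 \<le> j" "i + j \<le> n" "\<psi> i = 0" "\<psi> j \<noteq> 0"
  shows "\<psi> (i + j) = 0"
  using reynolds_weightD[OF assms(1-4)] assms(5,6) by simp

lemma reynolds_weight_zero_add_mult:
  fixes \<psi> :: "nat \<Rightarrow> 'a::idom"
  assumes "reynolds_weight n \<psi>" "1 \<le> r" "\<psi> r = 0" "1 \<le> t" "\<psi> t \<noteq> 0"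
  shows "r + k * t \<le> n \<Longrightarrow> \<psi> (r + k * t) = 0"
proof (induction k)
  case 0
  then show ?case using assms by simp
next
  case (Suc k)
  then show ?case
    using reynolds_weight_zero_add[OF assms(1), of "r + k * t" t] assms
    by (simp add: algebra_simps)
qed

text \<open>This is additivity of \<open>1 / \<psi> - 1\<close> on the multiples of \<open>t\<close>, cleared of denominators; it also
  shows that the denominator does not vanish.\<close>
lemma reynolds_weight_mult:
  fixes \<psi> :: "nat \<Rightarrow> 'a::idom"
  assumes w: "reynolds_weight n \<psi>" and t: "1 \<le> t" "\<psi> t \<noteq> 0"
  shows "Suc k * t \<le> n \<Longrightarrow> \<psi> (Suc k * t) * (of_nat (Suc k) - of_nat k * \<psi> t) = \<psi> t"
proof (induction k)
  case 0
  then show ?case by simp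
next
  case (Suc k)
  let ?x = "\<psi> (Suc k * t)" and ?y = "\<psi> (Suc (Suc k) * t)" and ?a = "\<psi> t"
  let ?d = "of_nat (Suc k) - of_nat k * ?a"
  have IH: "?x * ?d = ?a"
    using Suc by simp
  have rec: "?x * ?a = (?x + ?a - ?x * ?a) * ?y"
    using reynolds_weightD[OF w, of "Suc k * t" t] Suc.prems t by (simp add: algebra_simps)
  have "?a * ?a = (?x * ?d) * ?a"
    by (simp only: IH)
  also have "\<dots> = ?d * ((?x + ?a - ?x * ?a) * ?y)"
    by (simp only: rec[symmetric]) (simp only: mult_ac)
  also have "\<dots> = (?x * ?d + ?a * ?d - (?x * ?d) * ?a) * ?y"
    by (simp only: algebra_simps)
  also have "\<dots> = ?a * (?y * (of_nat (Suc (Suc k)) - of_nat (Suc k) * ?a))"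
    by (simp only: IH) (simp add: algebra_simps)
  finally show ?case
    using t(2) by simp
qed

text \<open>Minimality of \<open>t\<close> puts every nonzero remainder modulo \<open>t\<close>
  outside the support, and adding multiples of \<open>t\<close> keeps it there. On multiples of
  \<open>t\<close> the closed form follows by division; characteristic 0 makes the factor
  \<open>of_nat t\<close> of the denominator nonzero.\<close>

lemma reynolds_weight_periodic:
  fixes \<psi> :: "nat \<Rightarrow> 'a::field_char_0"
  assumes w: "reynolds_weight n \<psi>" and t: "1 \<le> t" "\<psi> t \<noteq> 0"
    and least: "\<And>r. 1 \<le> r \<Longrightarrow> r < t \<Longrightarrow> \<psi> r = 0"
    and i: "1 \<le> i" "i \<le> n"
  shows "i mod t = 0 \<Longrightarrow> of_nat i - (of_nat i - of_nat t) * \<psi> t \<noteq> 0 \<and>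
      \<psi> i = of_nat t * \<psi> t / (of_nat i - (of_nat i - of_nat t) * \<psi> t)"
    and "i mod t \<noteq> 0 \<Longrightarrow> \<psi> i = 0"
proof -
  assume "i mod t = 0"
  then obtain m where m: "i = m * t"
    by (metis mod_0_imp_dvd dvd_def mult.commute)
  with i obtain k where k: "i = Suc k * t"
    by (cases m) auto
  let ?d = "of_nat (Suc k) - of_nat k * \<psi> t"
  have eq: "\<psi> i * ?d = \<psi> t"
    using reynolds_weight_mult[OF w t, of k] i unfolding k by blast
  have den: "of_nat i - (of_nat i - of_nat t) * \<psi> t = of_nat t * ?d"
    unfolding k by (simp add: algebra_simps)
  have "?d \<noteq> 0"
    using eq t by auto
  moreover have "\<psi> i = \<psi> t / ?d"
    using eq \<open>?d \<noteq> 0\<close> by (simp only: nonzero_eq_divide_eq not_False_eq_True)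
  ultimately show "of_nat i - (of_nat i - of_nat t) * \<psi> t \<noteq> 0 \<and>
      \<psi> i = of_nat t * \<psi> t / (of_nat i - (of_nat i - of_nat t) * \<psi> t)"
    using t(1) unfolding den by (simp del: of_nat_Suc)
next
  assume "i mod t \<noteq> 0"
  moreover have "i mod t < t"
    using t by simp
  moreover have "i mod t + i div t * t = i"
    by (rule mod_div_mult_eq)
  ultimately show "\<psi> i = 0"
    using reynolds_weight_zero_add_mult[OF w, of "i mod t" t "i div t"] least[of "i mod t"] t i
    by simp
qed

lemma reynolds_weight_concentrated:
  fixes \<psi> :: "nat \<Rightarrow> 'a::idom"
  assumes w: "reynolds_weight n \<psi>" and n: "1 \<le> n"
    and low: "\<And>t. 1 \<le> t \<Longrightarrow> t \<le> n div 2 \<Longrightarrow> \<psi> t = 0"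
  shows "\<exists>r\<in>{n div 2<..n}. \<forall>i\<in>{1..n}. i \<noteq> r \<longrightarrow> \<psi> i = 0"
proof -
  have uniq: False if "1 \<le> r" "r < s" "s \<le> n" "\<psi> r \<noteq> 0" "\<psi> s \<noteq> 0" for r s
  proof -
    have "n div 2 < r"
      using low[of r] that by linarith
    \<comment> \<open>Here \<open>s - r \<le> n - (n div 2 + 1)\<close>, which is at most
      \<open>n div 2\<close> for either parity of \<open>n\<close>.\<close>
    then have "s - r \<le> n div 2"
      using that by linarith
    then have "\<psi> (s - r) = 0"
      using low that by simp
    then show False
      using reynolds_weight_zero_add[OF w, of "s - r" r] that by (simp add: Suc_le_eq)
  qed
  show ?thesis
  proof (cases "\<exists>r\<in>{1..n}. \<psi> r \<noteq> 0")
    case True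
    then obtain r where r: "1 \<le> r" "r \<le> n" "\<psi> r \<noteq> 0"
      by auto
    have "n div 2 < r"
      using low[of r] r by linarith
    moreover have "\<psi> i = 0" if "i \<in> {1..n}" "i \<noteq> r" for i
      using uniq[of r i] uniq[of i r] r that by (cases i r rule: linorder_cases) auto
    ultimately show ?thesis
      using r by (intro bexI[of _ r]) auto
  next
    \<comment> \<open>If \<psi> vanishes on \<open>{1..n}\<close>, any index above
      \<open>n div 2\<close> serves as \<open>r\<close>; \<open>n\<close> is one because it is
      positive.\<close>
    case False
    with n show ?thesis
      by (intro bexI[of _ n]) auto
  qed
qed

text \<open>In the first part \<open>t\<close> has to be chosen: for a non-least element of the
  support the formula would wrongly send the least one to 0, as that is not a multiple of it. The
  denominator is asserted to be nonzero because division by 0 yields 0 in HOL.\<close>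

theorem theorem3p9:
  fixes scale :: "complex \<Rightarrow> 'a::ab_group_add \<Rightarrow> 'a"
    and mult :: "'a \<Rightarrow> 'a \<Rightarrow> 'a"
    and n :: nat
    and e :: "nat \<Rightarrow> 'a"
    and \<psi> :: "nat \<Rightarrow> complex"
    and P :: "'a \<Rightarrow> 'a"
  assumes "null_filiform_algebra scale mult n e"
    and "homogeneous_operator_degree0 scale n e \<psi> P"
    and "reynolds_operator scale mult P"
  shows "((\<exists>t\<in>{1..n div 2}. \<psi> t \<noteq> 0) \<longrightarrow>
      (\<exists>t\<in>{1..n div 2}. \<psi> t \<noteq> 0 \<and>
        (\<forall>i\<in>{1..n}.
          (i mod t = 0 \<longrightarrow>
            of_nat i - (of_nat i - of_nat t) * \<psi> t \<noteq> 0 \<and>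
            P (e i) = scale (of_nat t * \<psi> t / (of_nat i - (of_nat i - of_nat t) * \<psi> t)) (e i)) \<and>
          (i mod t \<noteq> 0 \<longrightarrow> P (e i) = 0)))) \<and>
    ((\<forall>t\<in>{1..n div 2}. \<psi> t = 0) \<longrightarrow>
      (\<exists>r\<in>{n div 2<..n}. \<forall>i\<in>{1..n}.
        P (e i) = (if i = r then scale (\<psi> r) (e r) else 0)))"
proof (intro conjI impI)
  interpret null_filiform_algebra scale mult n e
    by (rule assms(1))
  have w: "reynolds_weight n \<psi>"
    using assms(2,3) by (rule reynolds_weight_of_operator)
  have Pe: "P (e i) = scale (\<psi> i) (e i)" if "i \<in> {1..n}" for i
    using assms(2) that by (simp add: homogeneous_operator_degree0_def)
  {
    assume "\<exists>t\<in>{1..n div 2}. \<psi> t \<noteq> 0"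
    then obtain s where s: "s \<in> {1..n div 2}" "\<psi> s \<noteq> 0"
      by blast
    \<comment> \<open>The minimum is over all positive indices; comparison with the witness
      \<open>s\<close> bounds it by \<open>n div 2\<close>.\<close>
    define t where "t = (LEAST t. 1 \<le> t \<and> \<psi> t \<noteq> 0)"
    have t: "1 \<le> t" "\<psi> t \<noteq> 0"
      using LeastI[of "\<lambda>t. 1 \<le> t \<and> \<psi> t \<noteq> 0" s] s by (auto simp: t_def)
    have ts: "t \<le> s"
      using s unfolding t_def by (auto intro: Least_le)
    have least: "\<psi> r = 0" if "1 \<le> r" "r < t" for r
      using not_less_Least[of r "\<lambda>t. 1 \<le> t \<and> \<psi> t \<noteq> 0"] that by (auto simp: t_def)
    show "\<exists>t\<in>{1..n div 2}. \<psi> t \<noteq> 0 \<and>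
        (\<forall>i\<in>{1..n}.
          (i mod t = 0 \<longrightarrow>
            of_nat i - (of_nat i - of_nat t) * \<psi> t \<noteq> 0 \<and>
            P (e i) = scale (of_nat t * \<psi> t / (of_nat i - (of_nat i - of_nat t) * \<psi> t)) (e i)) \<and>
          (i mod t \<noteq> 0 \<longrightarrow> P (e i) = 0))"
    proof (intro bexI[of _ t] conjI ballI impI)
      fix i assume i: "i \<in> {1..n}"
      note per = reynolds_weight_periodic[OF w t least, of i]
      show "of_nat i - (of_nat i - of_nat t) * \<psi> t \<noteq> 0" if "i mod t = 0"
        using per(1) i that by simp
      show "P (e i) = scale (of_nat t * \<psi> t / (of_nat i - (of_nat i - of_nat t) * \<psi> t)) (e i)"
        if "i mod t = 0"
        using per(1) Pe[OF i] i that by simp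
      show "P (e i) = 0" if "i mod t \<noteq> 0"
        using per(2) Pe[OF i] i that by simp
    qed (use t ts s in auto)
  next
    assume "\<forall>t\<in>{1..n div 2}. \<psi> t = 0"
    then obtain r where "r \<in> {n div 2<..n}" "\<forall>i\<in>{1..n}. i \<noteq> r \<longrightarrow> \<psi> i = 0"
      using reynolds_weight_concentrated[OF w dim_pos] by auto
    then show "\<exists>r\<in>{n div 2<..n}. \<forall>i\<in>{1..n}.
        P (e i) = (if i = r then scale (\<psi> r) (e r) else 0)"
      using Pe by (intro bexI[of _ r]) auto
  }
qed

end
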